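(* Let $\kappa>0$, $\alpha\in[0,2\pi)$, and let $\boldsymbol{n}:\mathbb{R}^2\to S^2\subset\mathbb{R}^3$ be twice continuously differentiable. Define the covariant derivatives $$D_i\boldsymbol{n}=\partial_i\boldsymbol{n}-\kappa\,\boldsymbol{e}_i^{-\alpha}\times\boldsymbol{n},\qquad i=1,2.$$ Then: (1) For every compact subset $D\subset\mathbb{R}^2$, $$E_D[\boldsymbol{n}]=4\pi\left(Q_D[\boldsymbol{n}]+\Omega_D[\boldsymbol{n}]\right)+\frac12\int_D\left(D_1\boldsymbol{n}+\boldsymbol{n}\times D_2\boldsymbol{n}\right)^2\,\mathrm{d}x_1\,\mathrm{d}x_2 .$$ (2) The equality $E_D[\boldsymbol{n}]=4\pi\left(Q_D[\boldsymbol{n}]+\Omega_D[\boldsymbol{n}]\right)$ holds for all compact subsets $D\subset\mathbb{R}^2$ if and only if the Bogomol'nyi equation $$D_1\boldsymbol{n}=-\boldsymbol{n}\times D_2\boldsymbol{n}$$ is satisfied on $\mathbb{R}^2$. (3) The Bogomol'nyi equation implies the variational equation $$2\kappa\,(\boldsymbol{n}\cdot\nabla_{-\alpha})\boldsymbol{n}=\left(\Delta\boldsymbol{n}+\kappa^2(1-n_3)\boldsymbol{e}_3\right)\times\boldsymbol{n}.$$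
   Context: $(x_1,x_2)$ are Cartesian coordinates on $\mathbb{R}^2$, $\partial_i=\partial/\partial x_i$, $\Delta=\partial_1^2+\partial_2^2$; $\boldsymbol{e}_1,\boldsymbol{e}_2,\boldsymbol{e}_3$ is the canonical basis of $\mathbb{R}^3$; $\cdot$ and $\times$ are the Euclidean scalar and vector products on $\mathbb{R}^3$, and $(\boldsymbol{u})^2=\boldsymbol{u}\cdot\boldsymbol{u}$. The field is $\boldsymbol{n}=(n_1,n_2,n_3)^t$ with $n_1^2+n_2^2+n_3^2=1$. For an angle $\beta$, $R(\beta)$ is the rotation of $\mathbb{R}^3$ about the 3-axis by $\beta$, and $\boldsymbol{e}_i^{\beta}=R(\beta)\boldsymbol{e}_i$, i.e. $\boldsymbol{e}_1^\beta=(\cos\beta,\sin\beta,0)^t$, $\boldsymbol{e}_2^\beta=(-\sin\beta,\cos\beta,0)^t$. Write $\nabla_\beta=\sum_{i=1}^2\boldsymbol{e}_i^\beta\partial_i$, so that $$\boldsymbol{n}\cdot\nabla_{-\alpha}\times\boldsymbol{n}=\sum_{i=1}^2\boldsymbol{n}\cdot(\boldsymbol{e}_i^{-\alpha}\times\partial_i\boldsymbol{n}),\qquad (\boldsymbol{n}\cdot\nabla_{-\alpha})\boldsymbol{n}=\sum_{i=1}^2(\boldsymbol{n}\cdot\boldsymbol{e}_i^{-\alpha})\,\partial_i\boldsymbol{n}.$$ Also $\boldsymbol{n}^\alpha=R(\alpha)\boldsymbol{n}=(n_1^\alpha,n_2^\alpha,n_3^\alpha)^t$ and $(\nabla\boldsymbol{n})^2=(\partial_1\boldsymbol{n})^2+(\partial_2\boldsymbol{n})^2$.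 For a compact subset $D\subset\mathbb{R}^2$ define $$E_D[\boldsymbol{n}]=\int_D\left(\tfrac12(\nabla\boldsymbol{n})^2+\kappa\,\boldsymbol{n}\cdot\nabla_{-\alpha}\times\boldsymbol{n}+\tfrac{\kappa^2}{2}(1-n_3)^2\right)\mathrm{d}x_1\,\mathrm{d}x_2,$$ $$Q_D[\boldsymbol{n}]=\frac1{4\pi}\int_D\boldsymbol{n}\cdot(\partial_1\boldsymbol{n}\times\partial_2\boldsymbol{n})\,\mathrm{d}x_1\,\mathrm{d}x_2,\qquad \Omega_D[\boldsymbol{n}]=\frac1{4\pi}\int_D\omega\,\mathrm{d}x_1\,\mathrm{d}x_2,$$ with $\omega=\kappa(\partial_1n_2^\alpha-\partial_2n_1^\alpha)$. *)

theory Defs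
  imports "HOL-Analysis.Analysis"
begin

unbundle cross3_syntax

definition pd :: "2 \<Rightarrow> (real^2 \<Rightarrow> 'a::real_normed_vector) \<Rightarrow> real^2 \<Rightarrow> 'a" where
  "pd i f x = frechet_derivative f (at x) (axis i 1)"

text \<open>
  \<open>Ck k f\<close>: \<open>f\<close> is \<open>k\<close> times continuously differentiable on the whole plane. Since \<open>pd\<close> is
  unspecified at points of non-differentiability, each step requires (Frechet) differentiability.
\<close>

primrec Ck :: "nat \<Rightarrow> (real^2 \<Rightarrow> 'a::real_normed_vector) \<Rightarrow> bool" where
  "Ck 0 f \<longleftrightarrow> continuous_on UNIV f"
| "Ck (Suc k) f \<longleftrightarrow> (\<forall>x. f differentiable (at x)) \<and> (\<forall>i. Ck k (pd i f))"

definition laplacian :: "(real^2 \<Rightarrow> real^3) \<Rightarrow> real^2 \<Rightarrow> real^3" where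
  "laplacian f x = (\<Sum>i\<in>UNIV. pd i (pd i f) x)"

definition rot :: "real \<Rightarrow> real^3^3" where
  "rot \<beta> = vector [vector [cos \<beta>, - sin \<beta>, 0],
                   vector [sin \<beta>,   cos \<beta>, 0],
                   vector [0,       0,       1]]"

text \<open>
  The index type \<open>2\<close> (elements \<open>1\<close> and \<open>2\<close>) is that of the partial derivatives; the
  embedding of the plane into space turns it into an index of the first two basis vectors of
  three-space, so that \<open>frame \<beta> i\<close> is $\boldsymbol{e}_i^\beta$.
\<close>

definition embed_plane :: "real^2 \<Rightarrow> real^3" where
  "embed_plane x = vector [x $ 1, x $ 2, 0]"

definition frame :: "real \<Rightarrow> 2 \<Rightarrow> real^3" where
  "frame \<beta> i = rot \<beta> *v embed_plane (axis i 1)"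

text \<open>
  With $\nabla_\beta = \sum_i \boldsymbol{e}_i^\beta \partial_i$: the scalar
  $\boldsymbol{n} \cdot \nabla_\beta \times \boldsymbol{n}$ and the vector
  $(\boldsymbol{n} \cdot \nabla_\beta) \boldsymbol{n}$.
\<close>

definition dot_curl :: "real \<Rightarrow> (real^2 \<Rightarrow> real^3) \<Rightarrow> real^2 \<Rightarrow> real" where
  "dot_curl \<beta> n x = (\<Sum>i\<in>UNIV. n x \<bullet> (frame \<beta> i \<times> pd i n x))"

definition convective :: "real \<Rightarrow> (real^2 \<Rightarrow> real^3) \<Rightarrow> real^2 \<Rightarrow> real^3" where
  "convective \<beta> n x = (\<Sum>i\<in>UNIV. (n x \<bullet> frame \<beta> i) *\<^sub>R pd i n x)"

definition grad_sq :: "(real^2 \<Rightarrow> real^3) \<Rightarrow> real^2 \<Rightarrow> real" where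
  "grad_sq n x = (\<Sum>i\<in>UNIV. pd i n x \<bullet> pd i n x)"

definition energy :: "real \<Rightarrow> real \<Rightarrow> (real^2 \<Rightarrow> real^3) \<Rightarrow> (real^2) set \<Rightarrow> real" where
  "energy \<kappa> \<alpha> n D =
     (LINT x:D|lborel. 1/2 * grad_sq n x + \<kappa> * dot_curl (- \<alpha>) n x + \<kappa>\<^sup>2 / 2 * (1 - n x $ 3)\<^sup>2)"

definition charge :: "(real^2 \<Rightarrow> real^3) \<Rightarrow> (real^2) set \<Rightarrow> real" where
  "charge n D = 1 / (4 * pi) * (LINT x:D|lborel. n x \<bullet> (pd 1 n x \<times> pd 2 n x))"

definition vorticity :: "real \<Rightarrow> real \<Rightarrow> (real^2 \<Rightarrow> real^3) \<Rightarrow> real^2 \<Rightarrow> real" where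
  "vorticity \<kappa> \<alpha> n x =
     \<kappa> * (pd 1 (\<lambda>y. (rot \<alpha> *v n y) $ 2) x - pd 2 (\<lambda>y. (rot \<alpha> *v n y) $ 1) x)"

definition total_vorticity :: "real \<Rightarrow> real \<Rightarrow> (real^2 \<Rightarrow> real^3) \<Rightarrow> (real^2) set \<Rightarrow> real" where
  "total_vorticity \<kappa> \<alpha> n D = 1 / (4 * pi) * (LINT x:D|lborel. vorticity \<kappa> \<alpha> n x)"

definition cov :: "real \<Rightarrow> real \<Rightarrow> 2 \<Rightarrow> (real^2 \<Rightarrow> real^3) \<Rightarrow> real^2 \<Rightarrow> real^3" where
  "cov \<kappa> \<alpha> i n x = pd i n x - \<kappa> *\<^sub>R (frame (- \<alpha>) i \<times> n x)"

definition bogomolnyi :: "real \<Rightarrow> real \<Rightarrow> (real^2 \<Rightarrow> real^3) \<Rightarrow> bool" where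
  "bogomolnyi \<kappa> \<alpha> n \<longleftrightarrow> (\<forall>x. cov \<kappa> \<alpha> 1 n x = - (n x \<times> cov \<kappa> \<alpha> 2 n x))"

end

theory Submission
  imports Defs
begin

text \<open>
  Expanding the square $\frac12(D_1n + n\times D_2n)^2$ with $|n|=1$ and $n\cdot\partial_in=0$ gives
  the energy density minus $n\cdot(\partial_1n\times\partial_2n)+\omega$ pointwise, which yields (1),
  and (2) since a continuous nonnegative function with vanishing integrals is zero. For (3), $D_i$ is
  a derivation of the cross product and $[D_1,D_2]v=\kappa^2e_3\times v$, so applying $D_1$ to
  $D_1n=-n\times D_2n$ and $D_2$ to the equivalent $D_2n=n\times D_1n$ gives
  $(D_1^2+D_2^2)n=-2D_1n\times D_2n-\kappa^2\,n\times(e_3\times n)$. Here $D_1n\times D_2n$ is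
  parallel to $n$, and the cross product with $n$ is the variational equation.
\<close>

subsection \<open>Partial derivatives\<close>

lemma pd_eqI: "(f has_derivative f') (at x) \<Longrightarrow> pd i f x = f' (axis i 1)"
  unfolding pd_def using frechet_derivative_at by metis

lemma pd_bounded_linear:
  assumes "bounded_linear h" "f differentiable (at x)"
  shows "pd i (\<lambda>y. h (f y)) x = h (pd i f x)"
proof -
  have "(f has_derivative frechet_derivative f (at x)) (at x)"
    using assms(2) frechet_derivative_works by blast
  from bounded_linear.has_derivative[OF assms(1) this] show ?thesis
    unfolding pd_def[of i f] by (rule pd_eqI)
qed

lemma pd_bounded_bilinear:
  assumes "bounded_bilinear h" "f differentiable (at x)" "g differentiable (at x)"
  shows "pd i (\<lambda>y. h (f y) (g y)) x = h (pd i f x) (g x) + h (f x) (pd i g x)"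
proof -
  have "(f has_derivative frechet_derivative f (at x)) (at x)"
    and "(g has_derivative frechet_derivative g (at x)) (at x)"
    using assms frechet_derivative_works by blast+
  from pd_eqI[OF bounded_bilinear.FDERIV[OF assms(1) this], of i] show ?thesis
    by (simp add: pd_def add.commute)
qed

lemma pd_diff:
  assumes "f differentiable (at x)" "g differentiable (at x)"
  shows "pd i (\<lambda>y. f y - g y) x = pd i f x - pd i g x"
proof -
  have "(f has_derivative frechet_derivative f (at x)) (at x)"
    and "(g has_derivative frechet_derivative g (at x)) (at x)"
    using assms frechet_derivative_works by blast+
  from pd_eqI[OF has_derivative_diff[OF this], of i] show ?thesis
    by (simp add: pd_def)
qed

section \<open>Symmetry of mixed second partial derivatives\<close>

lemma has_field_derivative_pd_line:
  fixes f :: "real^2 \<Rightarrow> real"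
  assumes "f differentiable (at (x + t *\<^sub>R axis i 1))"
  shows "((\<lambda>s. f (x + s *\<^sub>R axis i 1)) has_field_derivative pd i f (x + t *\<^sub>R axis i 1)) (at t within S)"
proof -
  let ?F = "frechet_derivative f (at (x + t *\<^sub>R axis i 1))"
  have 1: "(f has_derivative ?F) (at (x + t *\<^sub>R axis i 1))"
    using assms frechet_derivative_works by blast
  have 2: "((\<lambda>s. x + s *\<^sub>R axis i 1) has_derivative (\<lambda>s. s *\<^sub>R axis i 1)) (at t within S)"
    by (auto intro!: derivative_eq_intros)
  have "((\<lambda>s. f (x + s *\<^sub>R axis i 1)) has_derivative (\<lambda>s. ?F (s *\<^sub>R axis i 1))) (at t within S)"
    using has_derivative_compose[OF 2 1] .
  moreover have "linear ?F"
    using 1 has_derivative_linear by blast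
  ultimately show ?thesis
    by (simp add: has_field_derivative_def pd_def linear_cmul mult_commute_abs)
qed

text \<open>The mean value theorem is applied twice: along direction \<open>i\<close> to the
  difference of \<open>g\<close> on two parallel segments, which gives \<open>s\<close>, and then
  along direction \<open>j\<close> to \<open>pd i g\<close>, which gives \<open>t\<close>.\<close>

lemma double_difference_eq_pd_pd:
  fixes g :: "real^2 \<Rightarrow> real"
  assumes "0 < h" and dg: "\<And>y. g differentiable (at y)"
    and dp: "\<And>y. pd i g differentiable (at y)"
  shows "\<exists>s t. 0 < s \<and> s < h \<and> 0 < t \<and> t < h \<and>
    g (x + h *\<^sub>R axis i 1 + h *\<^sub>R axis j 1) - g (x + h *\<^sub>R axis i 1) - g (x + h *\<^sub>R axis j 1) + g x
      = h\<^sup>2 * pd j (pd i g) (x + s *\<^sub>R axis i 1 + t *\<^sub>R axis j 1)"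
proof -
  let ?p = "\<lambda>s. g ((x + h *\<^sub>R axis j 1) + s *\<^sub>R axis i 1) - g (x + s *\<^sub>R axis i 1)"
  have "\<exists>s. 0 < s \<and> s < h \<and> ?p h - ?p 0 =
      (h - 0) * (pd i g ((x + h *\<^sub>R axis j 1) + s *\<^sub>R axis i 1) - pd i g (x + s *\<^sub>R axis i 1))"
    by (rule MVT2[OF \<open>0 < h\<close>]) (intro DERIV_diff has_field_derivative_pd_line dg)
  then obtain s where s: "0 < s" "s < h" and es: "?p h - ?p 0 =
      h * (pd i g ((x + h *\<^sub>R axis j 1) + s *\<^sub>R axis i 1) - pd i g (x + s *\<^sub>R axis i 1))"
    by auto
  let ?q = "\<lambda>t. pd i g ((x + s *\<^sub>R axis i 1) + t *\<^sub>R axis j 1)"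
  have "\<exists>t. 0 < t \<and> t < h \<and> ?q h - ?q 0 =
      (h - 0) * pd j (pd i g) ((x + s *\<^sub>R axis i 1) + t *\<^sub>R axis j 1)"
    by (rule MVT2[OF \<open>0 < h\<close>]) (intro has_field_derivative_pd_line dp)
  then obtain t where t: "0 < t" "t < h"
    and et: "?q h - ?q 0 = h * pd j (pd i g) ((x + s *\<^sub>R axis i 1) + t *\<^sub>R axis j 1)"
    by auto
  have "?p h - ?p 0 = h * (?q h - ?q 0)"
    using es by (simp add: add.assoc add.commute add.left_commute)
  with et have "?p h - ?p 0 = h\<^sup>2 * pd j (pd i g) (x + s *\<^sub>R axis i 1 + t *\<^sub>R axis j 1)"
    by (simp add: power2_eq_square)
  then show ?thesis
    using s t by (intro exI[of _ s] exI[of _ t]) (simp add: algebra_simps)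
qed

text \<open>The double difference of \<open>g\<close> is symmetric in the two directions, so for
  every step size it ties a value of one mixed derivative near \<open>x\<close> to a value of the
  other. Continuity at \<open>x\<close> then excludes two different limits.\<close>

lemma pd_commute_real:
  fixes g :: "real^2 \<Rightarrow> real"
  assumes "Ck 2 g"
  shows "pd i (pd j g) x = pd j (pd i g) x"
proof (rule ccontr)
  have dg: "g differentiable (at y)" and dp: "pd k g differentiable (at y)"
    and cont: "continuous_on UNIV (pd l (pd k g))" for y k l
    using assms by (auto simp: numeral_2_eq_2)
  let ?a = "pd i (pd j g)" and ?b = "pd j (pd i g)"
  assume "?a x \<noteq> ?b x"
  then have e: "dist (?a x) (?b x) / 2 > 0" (is "?e > 0")
    by simp
  have "isCont ?a x" "isCont ?b x"
    using cont continuous_on_eq_continuous_at[of UNIV] by auto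
  then obtain d1 d2 where d: "d1 > 0" "d2 > 0"
    and d1: "\<And>y. dist y x < d1 \<Longrightarrow> dist (?a y) (?a x) < ?e"
    and d2: "\<And>y. dist y x < d2 \<Longrightarrow> dist (?b y) (?b x) < ?e"
    using e unfolding continuous_at_eps_delta by metis
  \<comment> \<open>An intermediate point is reached from \<open>x\<close> by two axis steps shorter
    than \<open>h\<close>, hence lies within \<open>2 * h\<close>; halving keeps it inside both
    continuity radii.\<close>
  define h where "h = min d1 d2 / 2"
  have h: "h > 0" "2 * h \<le> d1" "2 * h \<le> d2"
    using d by (auto simp: h_def)
  have near: "dist (x + s *\<^sub>R axis k 1 + t *\<^sub>R axis l 1) x < 2 * h"
    if "0 < s" "s < h" "0 < t" "t < h" for s t :: real and k l :: 2
  proof -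
    have "dist (x + s *\<^sub>R axis k 1 + t *\<^sub>R axis l 1) x
        \<le> norm (s *\<^sub>R (axis k 1 :: real^2)) + norm (t *\<^sub>R (axis l 1 :: real^2))"
      by (simp add: dist_norm add.assoc norm_triangle_ineq del: norm_scaleR)
    also have "\<dots> < 2 * h"
      using that by simp
    finally show ?thesis .
  qed
  obtain s t where st: "0 < s" "s < h" "0 < t" "t < h"
    and 1: "g (x + h *\<^sub>R axis i 1 + h *\<^sub>R axis j 1) - g (x + h *\<^sub>R axis i 1) - g (x + h *\<^sub>R axis j 1) + g x
      = h\<^sup>2 * ?b (x + s *\<^sub>R axis i 1 + t *\<^sub>R axis j 1)"
    using double_difference_eq_pd_pd[OF h(1) dg dp] by blast
  obtain s' t' where st': "0 < s'" "s' < h" "0 < t'" "t' < h"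
    and 2: "g (x + h *\<^sub>R axis j 1 + h *\<^sub>R axis i 1) - g (x + h *\<^sub>R axis j 1) - g (x + h *\<^sub>R axis i 1) + g x
      = h\<^sup>2 * ?a (x + s' *\<^sub>R axis j 1 + t' *\<^sub>R axis i 1)"
    using double_difference_eq_pd_pd[OF h(1) dg dp] by blast
  \<comment> \<open>The two double differences take their steps in opposite order but are the same
    number.\<close>
  have "h\<^sup>2 * ?b (x + s *\<^sub>R axis i 1 + t *\<^sub>R axis j 1) = h\<^sup>2 * ?a (x + s' *\<^sub>R axis j 1 + t' *\<^sub>R axis i 1)"
    unfolding 1[symmetric] 2[symmetric] by (simp add: algebra_simps)
  then have eq: "?b (x + s *\<^sub>R axis i 1 + t *\<^sub>R axis j 1) = ?a (x + s' *\<^sub>R axis j 1 + t' *\<^sub>R axis i 1)"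
    using h by simp
  have "dist (?b (x + s *\<^sub>R axis i 1 + t *\<^sub>R axis j 1)) (?b x) < ?e"
    using near[OF st] h by (intro d2) (meson less_le_trans)
  moreover have "dist (?a (x + s' *\<^sub>R axis j 1 + t' *\<^sub>R axis i 1)) (?a x) < ?e"
    using near[OF st'] h by (intro d1) (meson less_le_trans)
  \<comment> \<open>One common value would be closer than half the distance of \<open>?a x\<close>
    and \<open>?b x\<close> to both of them.\<close>
  ultimately show False
    unfolding eq by (metis dist_commute dist_triangle_half_l less_irrefl)
qed

lemma pd_inner_left:
  fixes f :: "real^2 \<Rightarrow> 'a::real_inner"
  shows "f differentiable (at x) \<Longrightarrow> pd i (\<lambda>y. f y \<bullet> v) x = pd i f x \<bullet> v"
  by (rule pd_bounded_linear[OF bounded_linear_inner_left])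

text \<open>The mean value argument needs real values, so the field is paired with a fixed vector
  \<open>v\<close>, which commutes with \<open>pd\<close>; a vector is determined by its inner
  products with all \<open>v\<close>.\<close>

lemma pd_commute:
  fixes f :: "real^2 \<Rightarrow> 'a::real_inner"
  assumes "Ck 2 f"
  shows "pd i (pd j f) x = pd j (pd i f) x"
proof -
  have df: "f differentiable (at y)" and dp: "pd k f differentiable (at y)"
    and cont: "continuous_on UNIV (pd l (pd k f))" for y k l
    using assms by (auto simp: numeral_2_eq_2)
  have "pd i (pd j f) x \<bullet> v = pd j (pd i f) x \<bullet> v" for v
  proof -
    have p1: "pd k (\<lambda>y. f y \<bullet> v) = (\<lambda>y. pd k f y \<bullet> v)" for k
      using pd_inner_left[OF df] by blast
    have p2: "pd l (\<lambda>y. pd k f y \<bullet> v) = (\<lambda>y. pd l (pd k f) y \<bullet> v)" for k l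
      using pd_inner_left[OF dp] by blast
    have "Ck 2 (\<lambda>y. f y \<bullet> v)"
      by (auto simp: numeral_2_eq_2 p1 p2 intro!: df dp cont continuous_intros differentiable_inner)
    from pd_commute_real[OF this, of i j x] show ?thesis
      by (simp add: p1 p2)
  qed
  then show ?thesis
    by (meson vector_eq_rdot)
qed

text \<open>Differentiating the constant \<open>f y \<bullet> f y\<close> gives twice this inner
  product.\<close>

lemma pd_orthogonal_if_unit:
  fixes f :: "real^2 \<Rightarrow> 'a::real_inner"
  assumes "\<And>y. f y \<bullet> f y = 1" "f differentiable (at x)"
  shows "f x \<bullet> pd i f x = 0"
proof -
  have "pd i (\<lambda>y. f y \<bullet> f y) x = 0"
    unfolding assms(1) by (rule pd_eqI[OF has_derivative_const])
  then show ?thesis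
    by (simp add: pd_bounded_bilinear[OF bounded_bilinear_inner assms(2,2)] inner_commute)
qed

subsection \<open>The frame\<close>

lemma frame_eq:
  "frame (- \<alpha>) 1 = vector [cos \<alpha>, - sin \<alpha>, 0]"
  "frame (- \<alpha>) 2 = vector [sin \<alpha>, cos \<alpha>, 0]"
  by (simp_all add: frame_def rot_def embed_plane_def vec_eq_iff forall_3 matrix_vector_mult_def
      sum_3 axis_def)

lemma frame_orthonormal:
  "frame (- \<alpha>) 1 \<bullet> frame (- \<alpha>) 1 = 1"
  "frame (- \<alpha>) 2 \<bullet> frame (- \<alpha>) 2 = 1"
  "frame (- \<alpha>) 1 \<bullet> frame (- \<alpha>) 2 = 0"
  using sin_cos_squared_add[of \<alpha>]
  by (simp_all add: frame_eq inner_vec_def sum_3 power2_eq_square add.commute)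

lemma frame_cross: "frame (- \<alpha>) 1 \<times> frame (- \<alpha>) 2 = axis 3 1"
  using sin_cos_squared_add[of \<alpha>]
  by (simp add: frame_eq vec_eq_iff forall_3 cross_components axis_def power2_eq_square add.commute)

text \<open>The inverse of a rotation is its transpose, so the first two rows of
  \<open>rot \<alpha>\<close> are the frame vectors for the angle \<open>- \<alpha>\<close>. This
  turns the rotated components in the vorticity into inner products with constant vectors.\<close>

lemma rot_nth:
  "(rot \<alpha> *v v) $ 1 = frame (- \<alpha>) 1 \<bullet> v"
  "(rot \<alpha> *v v) $ 2 = frame (- \<alpha>) 2 \<bullet> v"
  by (simp_all add: frame_eq rot_def matrix_vector_mult_def inner_vec_def sum_3)

lemma vorticity_eq:
  assumes "n differentiable (at x)"
  shows "vorticity \<kappa> \<alpha> n x = \<kappa> * (frame (- \<alpha>) 2 \<bullet> pd 1 n x - frame (- \<alpha>) 1 \<bullet> pd 2 n x)"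
  unfolding vorticity_def rot_nth
  by (simp add: pd_bounded_linear[OF bounded_linear_inner_right assms])

subsection \<open>The pointwise Bogomol'nyi identity\<close>

text \<open>Both sides are the squared length of \<open>m \<times> axis 3 1\<close>: once after
  expanding the triple product with \<open>e1 \<times> e2\<close>, once by the Lagrange identity for
  unit vectors.\<close>

lemma unit_orthonormal_frame_sum:
  fixes m :: "real^3"
  assumes "m \<bullet> m = 1" "e1 \<bullet> e1 = 1" "e2 \<bullet> e2 = 1" "e1 \<bullet> e2 = 0" "e1 \<times> e2 = axis 3 1"
  shows "(e1 \<bullet> m)\<^sup>2 + (e2 \<bullet> m)\<^sup>2 = 1 - (m $ 3)\<^sup>2"
proof -
  have m3: "m \<bullet> axis 3 1 = m $ 3"
    by (simp add: inner_axis)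
  have "m \<times> axis 3 1 = (m \<bullet> e2) *\<^sub>R e1 - (m \<bullet> e1) *\<^sub>R e2"
    unfolding assms(5)[symmetric] by (rule Lagrange)
  then have "(m \<times> axis 3 1) \<bullet> (m \<times> axis 3 1) = (e1 \<bullet> m)\<^sup>2 + (e2 \<bullet> m)\<^sup>2"
    using assms by (simp add: inner_diff_left inner_diff_right inner_commute power2_eq_square)
  moreover have "(m \<times> axis 3 1) \<bullet> (m \<times> axis 3 1) = 1 - (m $ 3)\<^sup>2"
    using assms(1) m3 by (simp add: dot_cross inner_commute power2_eq_square inner_axis)
  ultimately show ?thesis
    by simp
qed

text \<open>Pure algebra at one point: \<open>p\<close> and \<open>q\<close> stand for the partial
  derivatives of the field \<open>m\<close>, and \<open>P\<close> and \<open>Q\<close> for the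
  covariant ones. The squares of \<open>P\<close> and \<open>Q\<close> contribute
  \<open>1 + (m $ 3)\<^sup>2\<close> to the potential, and the mixed term supplies
  \<open>- 2 * m $ 3\<close>, which completes the square.\<close>

lemma bogomolnyi_identity:
  fixes m p q e1 e2 :: "real^3" and k :: real
  assumes m: "m \<bullet> m = 1" and mp: "m \<bullet> p = 0" and mq: "m \<bullet> q = 0"
    and e: "e1 \<bullet> e1 = 1" "e2 \<bullet> e2 = 1" "e1 \<bullet> e2 = 0" "e1 \<times> e2 = axis 3 1"
  defines "P \<equiv> p - k *\<^sub>R (e1 \<times> m)" and "Q \<equiv> q - k *\<^sub>R (e2 \<times> m)"
  shows "1/2 * (p \<bullet> p + q \<bullet> q) + k * (m \<bullet> (e1 \<times> p) + m \<bullet> (e2 \<times> q)) + k\<^sup>2 / 2 * (1 - m $ 3)\<^sup>2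
    = m \<bullet> (p \<times> q) + k * (e2 \<bullet> p - e1 \<bullet> q) + 1/2 * ((P + m \<times> Q) \<bullet> (P + m \<times> Q))"
proof -
  have sq: "(r - k *\<^sub>R (a \<times> m)) \<bullet> (r - k *\<^sub>R (a \<times> m))
      = r \<bullet> r + 2 * k * (m \<bullet> (a \<times> r)) + k\<^sup>2 * (1 - (a \<bullet> m)\<^sup>2)"
    if "a \<bullet> a = 1" for r a
  proof -
    have "r \<bullet> (a \<times> m) = - (m \<bullet> (a \<times> r))"
      by (metis cross_skew cross_triple inner_commute inner_minus_left)
    then show ?thesis
      using that m
      by (simp add: inner_diff_left inner_diff_right inner_commute dot_cross power2_eq_square algebra_simps)
  qed
  have mQ: "m \<bullet> Q = 0"
    by (simp add: Q_def inner_diff_right mq dot_cross_self)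
  \<comment> \<open>The next three facts evaluate the terms of
    \<open>m \<bullet> (Q \<times> P)\<close> that contain \<open>k\<close>: the first two produce
    the vorticity, the third the missing part of the potential.\<close>
  have t1: "m \<bullet> (q \<times> (e1 \<times> m)) = - (e1 \<bullet> q)"
    by (simp add: Lagrange inner_diff_right inner_commute m mq)
  have t2: "m \<bullet> ((e2 \<times> m) \<times> p) = e2 \<bullet> p"
  proof -
    have "m \<bullet> ((e2 \<times> m) \<times> p) = - (m \<bullet> (p \<times> (e2 \<times> m)))"
      by (metis cross_skew inner_minus_right)
    then show ?thesis
      by (simp add: Lagrange inner_diff_right inner_commute m mp)
  qed
  have t3: "m \<bullet> ((e2 \<times> m) \<times> (e1 \<times> m)) = - (m $ 3)"
  proof -
    have "m \<bullet> ((e2 \<times> m) \<times> (e1 \<times> m)) = - (e1 \<bullet> (e2 \<times> m))"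
      by (simp add: Lagrange inner_diff_right inner_commute m dot_cross_self)
    also have "e1 \<bullet> (e2 \<times> m) = m \<bullet> (e1 \<times> e2)"
      by (metis cross_triple inner_commute)
    finally show ?thesis
      by (simp add: e inner_axis)
  qed
  have "P \<bullet> (m \<times> Q) = m \<bullet> (Q \<times> P)"
    by (metis cross_triple inner_commute)
  also have "\<dots> = m \<bullet> (q \<times> p) - k * (m \<bullet> (q \<times> (e1 \<times> m))) - k * (m \<bullet> ((e2 \<times> m) \<times> p))
      + k\<^sup>2 * (m \<bullet> ((e2 \<times> m) \<times> (e1 \<times> m)))"
    by (simp add: P_def Q_def Cross3.left_diff_distrib Cross3.right_diff_distrib cross_mult_left
        cross_mult_right inner_diff_right algebra_simps power2_eq_square)
  also have "m \<bullet> (q \<times> p) = - (m \<bullet> (p \<times> q))"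
    by (metis cross_skew inner_minus_right)
  finally have PmQ: "P \<bullet> (m \<times> Q) = - (m \<bullet> (p \<times> q)) + k * (e1 \<bullet> q) - k * (e2 \<bullet> p) - k\<^sup>2 * m $ 3"
    by (simp add: t1 t2 t3)
  \<comment> \<open>Since \<open>m\<close> is a unit vector orthogonal to \<open>Q\<close>, the
    vectors \<open>m \<times> Q\<close> and \<open>Q\<close> have the same length.\<close>
  have "(P + m \<times> Q) \<bullet> (P + m \<times> Q) = P \<bullet> P + Q \<bullet> Q + 2 * (P \<bullet> (m \<times> Q))"
    by (simp add: inner_add_left inner_add_right dot_cross m mQ inner_commute[of Q m]
        inner_commute[of "m \<times> Q" P])
  also have "P \<bullet> P = p \<bullet> p + 2 * k * (m \<bullet> (e1 \<times> p)) + k\<^sup>2 * (1 - (e1 \<bullet> m)\<^sup>2)"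
    unfolding P_def by (rule sq[OF e(1)])
  also have "Q \<bullet> Q = q \<bullet> q + 2 * k * (m \<bullet> (e2 \<times> q)) + k\<^sup>2 * (1 - (e2 \<bullet> m)\<^sup>2)"
    unfolding Q_def by (rule sq[OF e(2)])
  finally have "(P + m \<times> Q) \<bullet> (P + m \<times> Q) = p \<bullet> p + q \<bullet> q
      + 2 * k * (m \<bullet> (e1 \<times> p) + m \<bullet> (e2 \<times> q)) + k\<^sup>2 * (2 - ((e1 \<bullet> m)\<^sup>2 + (e2 \<bullet> m)\<^sup>2))
      + 2 * (P \<bullet> (m \<times> Q))"
    by (simp add: algebra_simps)
  then have "(P + m \<times> Q) \<bullet> (P + m \<times> Q) = p \<bullet> p + q \<bullet> q
      + 2 * k * (m \<bullet> (e1 \<times> p) + m \<bullet> (e2 \<times> q)) + k\<^sup>2 * (1 + (m $ 3)\<^sup>2)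
      + 2 * (- (m \<bullet> (p \<times> q)) + k * (e1 \<bullet> q) - k * (e2 \<bullet> p) - k\<^sup>2 * m $ 3)"
    unfolding unit_orthonormal_frame_sum[OF m e] PmQ by simp
  then show ?thesis
    by algebra
qed

subsection \<open>Covariant derivatives\<close>

lemma bounded_bilinear_cross: "bounded_bilinear (\<times>)"
  using bilinear_cross bilinear_conv_bounded_bilinear by blast

lemma bounded_linear_cross_right: "bounded_linear ((\<times>) v)"
  using bounded_bilinear.bounded_linear_right[OF bounded_bilinear_cross] .

lemma differentiable_cross:
  assumes "f differentiable (at x)" "g differentiable (at x)"
  shows "(\<lambda>y. f y \<times> g y) differentiable (at x)"
  using assms bounded_bilinear.FDERIV[OF bounded_bilinear_cross] unfolding differentiable_def by blast

text \<open>By the Jacobi identity, crossing with a fixed vector is a derivation of the cross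
  product, just as \<open>pd i\<close> is; hence so is their combination.\<close>

lemma cov_cross:
  assumes "f differentiable (at x)" "g differentiable (at x)"
  shows "cov \<kappa> \<alpha> i (\<lambda>y. f y \<times> g y) x = cov \<kappa> \<alpha> i f x \<times> g x + f x \<times> cov \<kappa> \<alpha> i g x"
proof -
  let ?e = "frame (- \<alpha>) i" and ?u = "f x" and ?v = "g x"
  have "?u \<times> (?v \<times> ?e) = - (?u \<times> (?e \<times> ?v))"
    by (metis cross_minus_right cross_skew)
  moreover have "?v \<times> (?e \<times> ?u) = - ((?e \<times> ?u) \<times> ?v)"
    by (rule cross_skew)
  ultimately have "?e \<times> (?u \<times> ?v) = (?e \<times> ?u) \<times> ?v + ?u \<times> (?e \<times> ?v)"
    using Jacobi[of ?e ?u ?v] by (simp add: algebra_simps)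
  then show ?thesis
    by (simp add: cov_def pd_bounded_bilinear[OF bounded_bilinear_cross assms] cross_mult_left
        cross_mult_right Cross3.left_diff_distrib Cross3.right_diff_distrib scaleR_add_right)
qed

lemma cov_uminus:
  assumes "f differentiable (at x)"
  shows "cov \<kappa> \<alpha> i (\<lambda>y. - f y) x = - cov \<kappa> \<alpha> i f x"
  by (simp add: cov_def pd_bounded_linear[OF bounded_linear_minus[OF bounded_linear_ident] assms])

lemma cov_differentiable:
  assumes "n differentiable (at x)" "pd i n differentiable (at x)"
  shows "cov \<kappa> \<alpha> i n differentiable (at x)"
  unfolding cov_def
  by (intro differentiable_diff differentiable_scaleR differentiable_cross assms differentiable_const)

text \<open>The frame is constant, so derivatives fall on \<open>n\<close> only. The two first-order
  terms are together symmetric in \<open>i\<close> and \<open>j\<close>, which makes them cancel in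
  the commutator.\<close>

lemma cov_cov:
  assumes "n differentiable (at x)" "pd j n differentiable (at x)"
  shows "cov \<kappa> \<alpha> i (cov \<kappa> \<alpha> j n) x = pd i (pd j n) x
    - \<kappa> *\<^sub>R (frame (- \<alpha>) j \<times> pd i n x) - \<kappa> *\<^sub>R (frame (- \<alpha>) i \<times> pd j n x)
    + \<kappa>\<^sup>2 *\<^sub>R (frame (- \<alpha>) i \<times> (frame (- \<alpha>) j \<times> n x))"
proof -
  have bl: "bounded_linear (\<lambda>v. \<kappa> *\<^sub>R (frame (- \<alpha>) j \<times> v))"
    by (intro bounded_linear_const_scaleR bounded_linear_cross_right)
  have "pd i (cov \<kappa> \<alpha> j n) x = pd i (pd j n) x - \<kappa> *\<^sub>R (frame (- \<alpha>) j \<times> pd i n x)"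
    unfolding cov_def
    by (subst pd_diff) (auto simp: pd_bounded_linear[OF bl assms(1)]
        intro!: assms differentiable_scaleR differentiable_cross)
  then show ?thesis
    unfolding cov_def[of \<kappa> \<alpha> i]
    by (simp add: cov_def Cross3.right_diff_distrib cross_mult_right scaleR_diff_right power2_eq_square)
qed

text \<open>The constant curvature of the connection. Second-order terms cancel by symmetry of the
  mixed derivatives, and what remains is the commutator of two infinitesimal rotations, which is the
  rotation generated by \<open>?e1 \<times> ?e2\<close>.\<close>

lemma cov_commutator:
  assumes "Ck 2 n"
  shows "cov \<kappa> \<alpha> 1 (cov \<kappa> \<alpha> 2 n) x - cov \<kappa> \<alpha> 2 (cov \<kappa> \<alpha> 1 n) x = \<kappa>\<^sup>2 *\<^sub>R (axis 3 1 \<times> n x)"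
proof -
  have d: "n differentiable (at x)" "pd i n differentiable (at x)" for i
    using assms by (auto simp: numeral_2_eq_2)
  let ?e1 = "frame (- \<alpha>) 1" and ?e2 = "frame (- \<alpha>) 2"
  have "?e1 \<times> (?e2 \<times> n x) - ?e2 \<times> (?e1 \<times> n x) = (?e1 \<times> ?e2) \<times> n x"
    using Lagrange[of "n x" ?e1 ?e2] cross_skew[of "?e1 \<times> ?e2" "n x"]
    by (simp add: Lagrange inner_commute)
  then show ?thesis
    by (simp add: cov_cov d pd_commute[OF assms, of 2 1] frame_cross flip: scaleR_diff_right)
qed

section \<open>From the Bogomol'nyi equation to the variational equation\<close>

lemma cross_cross_orthogonal_unit:
  fixes m v :: "real^3"
  assumes "m \<bullet> m = 1" "m \<bullet> v = 0"
  shows "m \<times> (m \<times> v) = - v"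
  using assms by (simp add: Lagrange)

text \<open>The cross product of the covariant Laplacian with \<open>n\<close> is computed twice,
  from the first-order equation (\<open>sum2\<close>) and from the definition of \<open>cov\<close>;
  comparing the results gives the claim.\<close>

lemma bogomolnyi_imp_variational:
  assumes unit: "\<And>x. n x \<bullet> n x = 1" and n2: "Ck 2 n" and bog: "bogomolnyi \<kappa> \<alpha> n"
  shows "(2 * \<kappa>) *\<^sub>R convective (- \<alpha>) n x
    = (laplacian n x + (\<kappa>\<^sup>2 * (1 - n x $ 3)) *\<^sub>R axis 3 1) \<times> n x"
proof -
  let ?D = "cov \<kappa> \<alpha>" and ?e1 = "frame (- \<alpha>) 1" and ?e2 = "frame (- \<alpha>) 2"
  let ?E3 = "axis 3 1 :: real^3"
  have d: "n differentiable (at y)" "pd i n differentiable (at y)" for i y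
    using n2 by (auto simp: numeral_2_eq_2)
  note dc = cov_differentiable[OF d]
  have orth_pd: "n y \<bullet> pd i n y = 0" for i y
    by (rule pd_orthogonal_if_unit[OF unit d(1)])
  then have orth: "n y \<bullet> ?D i n y = 0" for i y
    by (simp add: cov_def inner_diff_right dot_cross_self)
  \<comment> \<open>An equality of functions, not just of values at \<open>x\<close>, so that
    another covariant derivative can be applied to both sides.\<close>
  have D1: "?D 1 n = (\<lambda>y. - (n y \<times> ?D 2 n y))"
    using bog by (auto simp: bogomolnyi_def)
  \<comment> \<open>Crossing with \<open>n\<close> is a quarter turn on the tangent plane, so
    applying it to \<open>D1\<close> solves for the other derivative.\<close>
  have D2: "?D 2 n = (\<lambda>y. n y \<times> ?D 1 n y)"
    by (rule ext) (simp add: D1 cross_cross_orthogonal_unit[OF unit orth])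
  have "?D 1 (?D 1 n) x = ?D 1 (\<lambda>y. - (n y \<times> ?D 2 n y)) x"
    using D1 by simp
  also have "\<dots> = - (?D 1 n x \<times> ?D 2 n x) - n x \<times> ?D 1 (?D 2 n) x"
    by (simp add: cov_uminus[OF differentiable_cross[OF d(1) dc]] cov_cross[OF d(1) dc])
  finally have DD1: "?D 1 (?D 1 n) x = - (?D 1 n x \<times> ?D 2 n x) - n x \<times> ?D 1 (?D 2 n) x" .
  have "?D 2 (?D 2 n) x = ?D 2 (\<lambda>y. n y \<times> ?D 1 n y) x"
    using D2 by simp
  also have "\<dots> = - (?D 1 n x \<times> ?D 2 n x) + n x \<times> ?D 2 (?D 1 n) x"
    by (simp add: cov_cross[OF d(1) dc] cross_skew[of "?D 2 n x"])
  finally have "?D 1 (?D 1 n) x + ?D 2 (?D 2 n) x = - 2 *\<^sub>R (?D 1 n x \<times> ?D 2 n x)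
      - n x \<times> (?D 1 (?D 2 n) x - ?D 2 (?D 1 n) x)"
    by (simp add: DD1 Cross3.right_diff_distrib scaleR_2)
  also have "\<dots> = - 2 *\<^sub>R (?D 1 n x \<times> ?D 2 n x) - \<kappa>\<^sup>2 *\<^sub>R (n x \<times> (?E3 \<times> n x))"
    by (simp add: cov_commutator[OF n2] cross_mult_right)
  finally have sum1: "(?D 1 (?D 1 n) x + ?D 2 (?D 2 n) x) \<times> n x
      = - 2 *\<^sub>R ((?D 1 n x \<times> ?D 2 n x) \<times> n x) - \<kappa>\<^sup>2 *\<^sub>R ((n x \<times> (?E3 \<times> n x)) \<times> n x)"
    by (simp add: Cross3.left_diff_distrib cross_mult_left)
  \<comment> \<open>Both factors are orthogonal to \<open>n x\<close>, so their cross product is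
    parallel to it.\<close>
  have "(?D 1 n x \<times> ?D 2 n x) \<times> n x = 0"
    using cross_skew[of "?D 1 n x \<times> ?D 2 n x" "n x"] orth[of x] by (simp add: Lagrange)
  moreover have "(n x \<times> (?E3 \<times> n x)) \<times> n x = ?E3 \<times> n x"
    by (simp add: Lagrange unit Cross3.left_diff_distrib cross_mult_left)
  ultimately have sum2: "(?D 1 (?D 1 n) x + ?D 2 (?D 2 n) x) \<times> n x = - \<kappa>\<^sup>2 *\<^sub>R (?E3 \<times> n x)"
    using sum1 by simp
  \<comment> \<open>Orthogonality to \<open>n x\<close> leaves one term of the triple product
    expansion; summed over the frame, it is the convective term.\<close>
  have conv: "(e \<times> pd i n x) \<times> n x = (n x \<bullet> e) *\<^sub>R pd i n x" for e i
    using cross_skew[of "e \<times> pd i n x" "n x"] orth_pd[of x i] by (simp add: Lagrange)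
  have ee: "(?e1 \<times> (?e1 \<times> n x) + ?e2 \<times> (?e2 \<times> n x)) \<times> n x = - (n x $ 3) *\<^sub>R (?E3 \<times> n x)"
  proof -
    have "?E3 \<times> ?e1 = ?e2" "?E3 \<times> ?e2 = - ?e1"
      using cross_skew[of ?E3 ?e1] cross_skew[of ?E3 ?e2] frame_orthonormal[of \<alpha>]
      by (simp_all add: Lagrange inner_commute flip: frame_cross[of \<alpha>])
    moreover have "n x \<times> ?E3 = (n x \<bullet> ?e2) *\<^sub>R ?e1 - (n x \<bullet> ?e1) *\<^sub>R ?e2"
      unfolding frame_cross[symmetric, of \<alpha>] by (rule Lagrange)
    \<comment> \<open>This vector is the horizontal part of \<open>n x\<close>, written here in the
      frame and next as \<open>n x\<close> minus its vertical part.\<close>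
    ultimately have "?E3 \<times> (n x \<times> ?E3) = (n x \<bullet> ?e1) *\<^sub>R ?e1 + (n x \<bullet> ?e2) *\<^sub>R ?e2"
      by (simp add: Cross3.right_diff_distrib cross_mult_right)
    moreover have "?E3 \<times> (n x \<times> ?E3) = n x - (n x $ 3) *\<^sub>R ?E3"
      by (simp add: Lagrange inner_axis inner_axis')
    ultimately have "?e1 \<times> (?e1 \<times> n x) + ?e2 \<times> (?e2 \<times> n x) = - n x - (n x $ 3) *\<^sub>R ?E3"
      by (simp add: Lagrange frame_orthonormal inner_commute algebra_simps)
    then show ?thesis
      by (simp add: Cross3.left_diff_distrib cross_mult_left)
  qed
  have "(?D 1 (?D 1 n) x + ?D 2 (?D 2 n) x) \<times> n x
      = laplacian n x \<times> n x - (2 * \<kappa>) *\<^sub>R convective (- \<alpha>) n x - (\<kappa>\<^sup>2 * n x $ 3) *\<^sub>R (?E3 \<times> n x)"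
  proof -
    \<comment> \<open>For equal indices the two first-order terms of \<open>cov_cov\<close>
      coincide, whence the factor 2.\<close>
    have "?D 1 (?D 1 n) x + ?D 2 (?D 2 n) x = laplacian n x
        - (2 * \<kappa>) *\<^sub>R (?e1 \<times> pd 1 n x + ?e2 \<times> pd 2 n x)
        + \<kappa>\<^sup>2 *\<^sub>R (?e1 \<times> (?e1 \<times> n x) + ?e2 \<times> (?e2 \<times> n x))"
      by (simp add: cov_cov d laplacian_def sum_2 algebra_simps flip: scaleR_2)
    moreover have "(u - a *\<^sub>R v + b *\<^sub>R w) \<times> n x = u \<times> n x - a *\<^sub>R (v \<times> n x) + b *\<^sub>R (w \<times> n x)"
      for u v w a b
      by (simp add: Cross3.left_diff_distrib cross_add_left cross_mult_left)
    moreover have "(?e1 \<times> pd 1 n x + ?e2 \<times> pd 2 n x) \<times> n x = convective (- \<alpha>) n x"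
      by (simp add: cross_add_left conv convective_def sum_2)
    ultimately show ?thesis
      by (simp add: ee)
  qed
  with sum2 show ?thesis
    by (simp add: cross_add_left cross_mult_left Cross3.left_diff_distrib algebra_simps)
qed

subsection \<open>Integration\<close>

lemma set_integrable_compact:
  fixes f :: "'a::euclidean_space \<Rightarrow> real"
  assumes "compact D" "continuous_on UNIV f"
  shows "set_integrable lborel D f"
  unfolding set_integrable_def
  using borel_integrable_compact[OF assms(1) continuous_on_subset[OF assms(2)]] by auto

text \<open>A box around \<open>x\<close> with nonempty interior is a suitable \<open>D\<close>:
  there a continuous nonnegative function with integral zero vanishes identically. The criterion
  concerns the gauge integral, so the Lebesgue integral is converted first.\<close>

lemma continuous_nonneg_eq_0_if_integrals_0:
  fixes f :: "'a::euclidean_space \<Rightarrow> real"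
  assumes cont: "continuous_on UNIV f" and nonneg: "\<And>x. 0 \<le> f x"
    and int0: "\<And>D. compact D \<Longrightarrow> (LINT x:D|lborel. f x) = 0"
  shows "f x = 0"
proof -
  let ?B = "cbox (x - One) (x + One)"
  have "integral ?B f = 0"
    using int0[OF compact_cbox] set_borel_integral_eq_integral(2)[OF set_integrable_compact[OF compact_cbox cont]]
    by metis
  moreover have "box (x - One) (x + One) \<noteq> {}"
    by (auto simp: box_ne_empty inner_diff_left inner_add_left)
  moreover have "x \<in> ?B"
    by (auto simp: mem_box inner_diff_left inner_add_left)
  ultimately show ?thesis
    using integral_cbox_eq_0_iff[OF continuous_on_subset[OF cont]] nonneg by blast
qed

theorem lemma3p1:
  fixes \<kappa> \<alpha> :: real and n :: "real^2 \<Rightarrow> real^3"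
  assumes "\<kappa> > 0" and "\<alpha> \<in> {0..<2 * pi}"
    and "range n \<subseteq> sphere 0 1" and "Ck 2 n"
  shows
    "(\<forall>D. compact D \<longrightarrow>
        energy \<kappa> \<alpha> n D = 4 * pi * (charge n D + total_vorticity \<kappa> \<alpha> n D)
          + 1/2 * (LINT x:D|lborel.
              (cov \<kappa> \<alpha> 1 n x + n x \<times> cov \<kappa> \<alpha> 2 n x) \<bullet>
              (cov \<kappa> \<alpha> 1 n x + n x \<times> cov \<kappa> \<alpha> 2 n x)))
     \<and> ((\<forall>D. compact D \<longrightarrow>
            energy \<kappa> \<alpha> n D = 4 * pi * (charge n D + total_vorticity \<kappa> \<alpha> n D))
          \<longleftrightarrow> bogomolnyi \<kappa> \<alpha> n)
     \<and> (bogomolnyi \<kappa> \<alpha> n \<longrightarrow>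
          (\<forall>x. (2 * \<kappa>) *\<^sub>R convective (- \<alpha>) n x
             = (laplacian n x + (\<kappa>\<^sup>2 * (1 - n x $ 3)) *\<^sub>R axis 3 1) \<times> n x))"
proof -
  have unit: "n x \<bullet> n x = 1" for x
  proof -
    have "norm (n x) = 1"
      using assms(3) by (auto simp: image_subset_iff)
    then show ?thesis
      by (simp add: dot_square_norm)
  qed
  have d: "n differentiable (at x)" "pd i n differentiable (at x)" for i x
    using assms(4) by (auto simp: numeral_2_eq_2)
  have orth_pd: "n x \<bullet> pd i n x = 0" for i x
    by (rule pd_orthogonal_if_unit[OF unit d(1)])
  have cont_n: "continuous_on UNIV n" and cont_pd: "continuous_on UNIV (pd i n)" for i
    using d by (auto intro!: continuous_at_imp_continuous_on differentiable_imp_continuous_within)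
  define F where "F x = (cov \<kappa> \<alpha> 1 n x + n x \<times> cov \<kappa> \<alpha> 2 n x) \<bullet> (cov \<kappa> \<alpha> 1 n x + n x \<times> cov \<kappa> \<alpha> 2 n x)" for x
  let ?q = "\<lambda>x. n x \<bullet> (pd 1 n x \<times> pd 2 n x)"
  have cont_q: "continuous_on UNIV ?q"
    by (intro continuous_intros continuous_on_cross cont_n cont_pd)
  have cont_w: "continuous_on UNIV (vorticity \<kappa> \<alpha> n)"
    unfolding vorticity_eq[OF d(1), abs_def] by (intro continuous_intros cont_pd)
  have cont_F: "continuous_on UNIV F"
    unfolding F_def cov_def by (intro continuous_intros continuous_on_cross cont_n cont_pd)
  \<comment> \<open>The algebraic identity with \<open>n x\<close>, \<open>pd 1 n x\<close> and
    \<open>pd 2 n x\<close> for \<open>m\<close>, \<open>p\<close> and \<open>q\<close>.\<close>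
  have density: "1/2 * grad_sq n x + \<kappa> * dot_curl (- \<alpha>) n x + \<kappa>\<^sup>2 / 2 * (1 - n x $ 3)\<^sup>2
      = ?q x + vorticity \<kappa> \<alpha> n x + 1/2 * F x" for x
    using bogomolnyi_identity[OF unit[of x] orth_pd[of x 1] orth_pd[of x 2]
        frame_orthonormal[of \<alpha>] frame_cross[of \<alpha>], of \<kappa>]
    by (simp add: grad_sq_def dot_curl_def sum_2 vorticity_eq[OF d(1)] F_def cov_def)
  have energy: "energy \<kappa> \<alpha> n D = 4 * pi * (charge n D + total_vorticity \<kappa> \<alpha> n D)
      + 1/2 * (LINT x:D|lborel. F x)" if "compact D" for D
  proof -
    \<comment> \<open>Splitting the integral requires each summand to be integrable; continuity on a
      compact set provides this.\<close>
    note int = set_integrable_compact[OF that]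
    have "energy \<kappa> \<alpha> n D = (LINT x:D|lborel. ?q x) + (LINT x:D|lborel. vorticity \<kappa> \<alpha> n x)
        + (LINT x:D|lborel. 1/2 * F x)"
      unfolding energy_def density
      by (simp only: set_integral_add int cont_q cont_w cont_F continuous_on_add continuous_on_mult_left)
    then show ?thesis
      by (simp add: charge_def total_vorticity_def algebra_simps)
  qed
  \<comment> \<open>\<open>F x\<close> is the inner product of a vector with itself, so it vanishes
    exactly when that vector does.\<close>
  have F0: "F x = 0 \<longleftrightarrow> cov \<kappa> \<alpha> 1 n x = - (n x \<times> cov \<kappa> \<alpha> 2 n x)" for x
    by (simp add: F_def add_eq_0_iff2)
  have "(\<forall>D. compact D \<longrightarrow> energy \<kappa> \<alpha> n D = 4 * pi * (charge n D + total_vorticity \<kappa> \<alpha> n D))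
      \<longleftrightarrow> bogomolnyi \<kappa> \<alpha> n" (is "?L \<longleftrightarrow> _")
  proof
    assume ?L
    then have "(LINT x:D|lborel. F x) = 0" if "compact D" for D
      using energy[OF that] that by simp
    then have "F x = 0" for x
      by (intro continuous_nonneg_eq_0_if_integrals_0[OF cont_F]) (auto simp: F_def)
    then show "bogomolnyi \<kappa> \<alpha> n"
      by (simp add: bogomolnyi_def F0)
  next
    assume "bogomolnyi \<kappa> \<alpha> n"
    then have "F x = 0" for x
      by (simp add: bogomolnyi_def F0)
    then show ?L
      by (simp add: energy set_lebesgue_integral_def)
  qed
  then show ?thesis
    using energy bogomolnyi_imp_variational[OF unit assms(4)] unfolding F_def by blast
qed

end
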